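(* Let $C$ be the Cantor set and suppose $X$ is a compact and perfect metric space. Then $X$ and $C$ are Boolean equivalent.
   Context: A metric space is perfect if it has no isolated points. For a compact Hausdorff space $X$, an open set $V\subseteq X$ is regular open if $V=\operatorname{int}(\operatorname{cl}(V))$; $\mathrm{Ropen}(X)$ denotes the Boolean algebra of regular open subsets of $X$ with operations $V_1\vee V_2=\operatorname{int}(\operatorname{cl}(V_1\cup V_2))$, $V_1\wedge V_2=V_1\cap V_2$, $\neg V=X\setminus\operatorname{cl}(V)$. Two compact Hausdorff spaces $X$ and $Y$ are Boolean equivalent if there is a Boolean algebra isomorphism between $\mathrm{Ropen}(X)$ and $\mathrm{Ropen}(Y)$. *)

theory Defs
  imports "HOL-Analysis.Analysis"
begin

definition isolated_point :: "'a topology \<Rightarrow> 'a \<Rightarrow> bool" where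
  "isolated_point X x \<longleftrightarrow> x \<in> topspace X \<and> openin X {x}"

definition perfect_topology :: "'a topology \<Rightarrow> bool" where
  "perfect_topology X \<longleftrightarrow> \<not> (\<exists>x. isolated_point X x)"

definition regular_open :: "'a topology \<Rightarrow> 'a set \<Rightarrow> bool" where
  "regular_open X V \<longleftrightarrow> openin X V \<and> V = X interior_of (X closure_of V)"

record 'b bool_alg =
  carrier :: "'b set"
  join :: "'b \<Rightarrow> 'b \<Rightarrow> 'b"
  meet :: "'b \<Rightarrow> 'b \<Rightarrow> 'b"
  compl :: "'b \<Rightarrow> 'b"
  zero :: "'b"
  one :: "'b"

definition Ropen :: "'a topology \<Rightarrow> 'a set bool_alg" where
  "Ropen X =
    \<lparr>carrier = {V. regular_open X V},
     join = (\<lambda>V W. X interior_of (X closure_of (V \<union> W))),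
     meet = (\<lambda>V W. V \<inter> W),
     compl = (\<lambda>V. topspace X - X closure_of V),
     zero = {},
     one = topspace X\<rparr>"

definition bool_alg_iso :: "('a \<Rightarrow> 'b) \<Rightarrow> 'a bool_alg \<Rightarrow> 'b bool_alg \<Rightarrow> bool" where
  "bool_alg_iso h A B \<longleftrightarrow>
     bij_betw h (carrier A) (carrier B) \<and>
     (\<forall>x\<in>carrier A. \<forall>y\<in>carrier A. h (join A x y) = join B (h x) (h y)) \<and>
     (\<forall>x\<in>carrier A. \<forall>y\<in>carrier A. h (meet A x y) = meet B (h x) (h y)) \<and>
     (\<forall>x\<in>carrier A. h (compl A x) = compl B (h x)) \<and>
     h (zero A) = zero B \<and> h (one A) = one B"

text \<open>The notion is meant for compact Hausdorff spaces, but makes sense for all topologies.\<close>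

definition boolean_equivalent :: "'a topology \<Rightarrow> 'b topology \<Rightarrow> bool" where
  "boolean_equivalent X Y \<longleftrightarrow> (\<exists>h. bool_alg_iso h (Ropen X) (Ropen Y))"

text \<open>The middle-thirds Cantor set: \<open>(cantor_step ^^ n) {0..1}\<close> is the union of the
  \<open>2 ^ n\<close> closed intervals of length \<open>1 / 3 ^ n\<close> left after \<open>n\<close> removals of open
  middle thirds.\<close>

definition cantor_step :: "real set \<Rightarrow> real set" where
  "cantor_step A = (\<lambda>x. x / 3) ` A \<union> (\<lambda>x. (x + 2) / 3) ` A"

definition cantor_set :: "real set" where
  "cantor_set = (\<Inter>n. (cantor_step ^^ n) {0..1})"

end

theory Submission
  imports Defs "HOL-Library.Sublist"
begin

text \<open>
  Both spaces carry a \<open>\<pi>\<close>-base \<open>(U s)\<close> indexed by the finite binary words such that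
  \<open>U s\<close> and \<open>U t\<close> meet exactly if \<open>s\<close> and \<open>t\<close> are comparable. A regular open set is the
  regularisation of the union of the members of a \<open>\<pi>\<close>-base below it, and whether
  \<open>U s\<close> lies in that regularisation can be read off from which members of the
  \<open>\<pi>\<close>-base meet; so the two regular open algebras are order isomorphic.
  The \<open>\<pi>\<close>-base arises by splitting the space again and again: at level \<open>n\<close>, each piece
  that meets the \<open>n\<close>-th set \<open>B n\<close> of a countable base is split so that one half lies in \<open>B n\<close>.
  The pieces of each level are dense, so every \<open>B n \<noteq> {}\<close> is hit.
\<close>

section \<open>Order isomorphisms of regular open algebras\<close>

text \<open>The operator int cl is idempotent: the closure of \<open>?R\<close> stays inside the
  closed set cl S, and \<open>?R\<close> is open, so it lies in the interior of its own
  closure.\<close>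

lemma regular_open_interior_of_closure_of:
  "regular_open X (X interior_of (X closure_of S))"
proof -
  let ?R = "X interior_of (X closure_of S)"
  have "X closure_of ?R \<subseteq> X closure_of S"
    by (simp add: closure_of_minimal interior_of_subset)
  then have "X interior_of (X closure_of ?R) \<subseteq> ?R"
    by (rule interior_of_mono)
  moreover have "?R \<subseteq> X interior_of (X closure_of ?R)"
    by (simp add: interior_of_maximal closure_of_subset interior_of_subset_topspace)
  ultimately show ?thesis
    by (auto simp: regular_open_def)
qed

lemma regular_openD:
  assumes "regular_open X V"
  shows "openin X V" "X interior_of (X closure_of V) = V"
  using assms by (auto simp: regular_open_def)

lemma subset_regular_open:
  assumes "regular_open X V" "openin X U" "U \<subseteq> X closure_of V"
  shows "U \<subseteq> V"
  using interior_of_maximal[OF assms(3,2)] regular_openD(2)[OF assms(1)] by simp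

lemma openin_subset_regularization:
  assumes "openin X U" "U \<subseteq> S" "S \<subseteq> topspace X"
  shows "U \<subseteq> X interior_of (X closure_of S)"
  by (meson assms closure_of_subset interior_of_maximal order_trans)

lemma regularization_subset:
  assumes "regular_open X V" "S \<subseteq> V"
  shows "X interior_of (X closure_of S) \<subseteq> V"
  by (metis assms closure_of_mono interior_of_mono regular_openD(2))

lemma regular_open_empty: "regular_open X {}"
  by (simp add: regular_open_def)

lemma regular_open_topspace: "regular_open X (topspace X)"
  by (simp add: regular_open_def)

lemma regular_open_Int:
  assumes "regular_open X V" "regular_open X W"
  shows "regular_open X (V \<inter> W)"
proof -
  have op: "openin X (V \<inter> W)"
    using assms by (auto simp: regular_open_def)
  have "X interior_of (X closure_of (V \<inter> W)) \<subseteq> V \<inter> W"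
    using assms by (auto dest: regularization_subset[where S="V \<inter> W"])
  moreover have "V \<inter> W \<subseteq> X interior_of (X closure_of (V \<inter> W))"
    by (rule openin_subset_regularization) (auto simp: op openin_subset)
  ultimately show ?thesis
    using op by (auto simp: regular_open_def)
qed

text \<open>The interior of a closed set is always regular open, and the complement of cl V is the
  interior of the closed set \<open>topspace X - V\<close>.\<close>

lemma regular_open_Compl:
  assumes "regular_open X V"
  shows "regular_open X (topspace X - X closure_of V)"
proof -
  have "topspace X - X closure_of V = X interior_of (topspace X - V)"
    by (simp add: interior_of_complement)
  also have "\<dots> = X interior_of (X closure_of (topspace X - V))"
    using regular_openD(1)[OF assms]
    by (metis closure_of_eq closedin_topspace closedin_diff)
  finally show ?thesis
    using regular_open_interior_of_closure_of by metis
qed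

text \<open>This makes the Boolean complement the largest open set disjoint from \<open>V\<close>, a
  description by meet and order alone, which an order isomorphism must respect.\<close>

lemma regular_open_disjoint_iff:
  assumes "openin X Z"
  shows "Z \<inter> V = {} \<longleftrightarrow> Z \<subseteq> topspace X - X closure_of V"
proof -
  have "Z \<inter> X closure_of V = {} \<longleftrightarrow> Z \<inter> V = {}"
    by (rule openin_Int_closure_of_eq_empty[OF assms])
  then show ?thesis
    using openin_subset[OF assms] by blast
qed

text \<open>All Boolean operations are determined by inclusion: meets and joins are greatest lower
  and least upper bounds, and complements are the largest disjoint elements. Hence a monotone
  bijection with monotone inverse preserves them.\<close>

lemma boolean_equivalentI:
  assumes h: "\<And>V. regular_open X V \<Longrightarrow> regular_open Y (h V)"
    and g: "\<And>W. regular_open Y W \<Longrightarrow> regular_open X (g W)"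
    and gh: "\<And>V. regular_open X V \<Longrightarrow> g (h V) = V"
    and hg: "\<And>W. regular_open Y W \<Longrightarrow> h (g W) = W"
    and mono_h: "\<And>V V'. V \<subseteq> V' \<Longrightarrow> h V \<subseteq> h V'"
    and mono_g: "\<And>W W'. W \<subseteq> W' \<Longrightarrow> g W \<subseteq> g W'"
  shows "boolean_equivalent X Y"
proof -
  \<comment> \<open>\<open>h\<close> and \<open>g\<close> are adjoint on both sides. Each equation
    for \<open>h\<close> below becomes two inclusions, moved across by these rules to the side where
    the bound is known.\<close>
  have adj: "h V \<subseteq> W \<longleftrightarrow> V \<subseteq> g W" "W \<subseteq> h V \<longleftrightarrow> g W \<subseteq> V"
    if "regular_open X V" "regular_open Y W" for V W
    using that mono_h mono_g gh hg by metis+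
  have h_empty: "h {} = {}"
    using adj(1)[OF regular_open_empty regular_open_empty] by simp
  have h_top: "h (topspace X) = topspace Y"
    using adj(2)[of "topspace X" "topspace Y"] g[OF regular_open_topspace] h[OF regular_open_topspace]
    by (metis openin_subset regular_openD(1) regular_open_topspace subset_antisym)
  have h_Int: "h (V \<inter> V') = h V \<inter> h V'" if V: "regular_open X V" "regular_open X V'" for V V'
  proof
    show "h (V \<inter> V') \<subseteq> h V \<inter> h V'"
      by (simp add: mono_h)
    have r: "regular_open Y (h V \<inter> h V')"
      by (intro regular_open_Int h V)
    then have "g (h V \<inter> h V') \<subseteq> V \<inter> V'"
      using V adj(2) by (metis Int_lower1 Int_lower2 Int_greatest)
    then show "h V \<inter> h V' \<subseteq> h (V \<inter> V')"
      using adj(2) V r regular_open_Int by blast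
  qed
  have h_join: "h (X interior_of (X closure_of (V \<union> V'))) = Y interior_of (Y closure_of (h V \<union> h V'))"
    (is "h ?J = ?K")
    if V: "regular_open X V" "regular_open X V'" for V V'
  proof
    have J: "regular_open X ?J" and K: "regular_open Y ?K"
      by (rule regular_open_interior_of_closure_of)+
    have hV: "openin Y (h V)" "openin Y (h V')" "openin X V" "openin X V'"
      using V h regular_openD(1) by auto
    have "V \<subseteq> ?J" "V' \<subseteq> ?J"
      using hV(3,4) by (simp_all add: openin_subset_regularization openin_subset del: closure_of_Un)
    then show "?K \<subseteq> h ?J"
      using h[OF J] mono_h by (metis Un_least regularization_subset)
    have "h V \<subseteq> ?K" "h V' \<subseteq> ?K"
      using hV(1,2) by (simp_all add: openin_subset_regularization openin_subset del: closure_of_Un)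
    then have "V \<subseteq> g ?K" "V' \<subseteq> g ?K"
      using adj(1) V K by auto
    then have "?J \<subseteq> g ?K"
      using g[OF K] by (metis Un_least regularization_subset)
    then show "h ?J \<subseteq> ?K"
      using adj(1)[OF J K] by simp
  qed
  have h_compl: "h (topspace X - X closure_of V) = topspace Y - Y closure_of h V" (is "h ?C = ?D")
    if V: "regular_open X V" for V
  proof
    have C: "regular_open X ?C" and D: "regular_open Y ?D"
      by (simp_all add: V h regular_open_Compl)
    have "?C \<inter> V = {}"
      using regular_open_disjoint_iff[OF regular_openD(1)[OF C]] by simp
    then have "h ?C \<inter> h V = {}"
      using h_Int[OF C V] h_empty by simp
    then show "h ?C \<subseteq> ?D"
      using regular_open_disjoint_iff[OF regular_openD(1)[OF h[OF C]]] by simp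
    have "?D \<inter> h V = {}"
      using regular_open_disjoint_iff[OF regular_openD(1)[OF D]] by simp
    \<comment> \<open>Disjointness is pulled back to \<open>X\<close>: the regular open set
      \<open>g ?D \<inter> V\<close> has empty image, hence is empty because \<open>h\<close> is
      injective on regular open sets.\<close>
    then have "h (g ?D \<inter> V) = {}"
      using h_Int[OF g[OF D] V] hg[OF D] by simp
    then have "g ?D \<inter> V = {}"
      using gh[OF regular_open_Int[OF g[OF D] V]] gh[OF regular_open_empty] h_empty by simp
    then have "g ?D \<subseteq> ?C"
      using regular_open_disjoint_iff[OF regular_openD(1)[OF g[OF D]]] by simp
    then show "?D \<subseteq> h ?C"
      using adj(2)[OF C D] by simp
  qed
  have "bij_betw h {V. regular_open X V} {W. regular_open Y W}"
    by (rule bij_betw_byWitness[where f'=g]) (auto simp: h g gh hg)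
  then have "bool_alg_iso h (Ropen X) (Ropen Y)"
    unfolding bool_alg_iso_def Ropen_def by (simp add: h_empty h_top h_Int h_join h_compl del: closure_of_Un)
  then show ?thesis
    by (auto simp: boolean_equivalent_def)
qed

section \<open>Indexed \<open>\<pi>\<close>-bases\<close>

text \<open>The family is indexed, rather than a set of sets, so that two spaces can be compared
  member by member through a common index type.\<close>

definition pi_base :: "'a topology \<Rightarrow> ('i \<Rightarrow> 'a set) \<Rightarrow> bool" where
  "pi_base X U \<longleftrightarrow> (\<forall>i. openin X (U i) \<and> U i \<noteq> {}) \<and>
     (\<forall>G. openin X G \<and> G \<noteq> {} \<longrightarrow> (\<exists>i. U i \<subseteq> G))"

definition transport :: "('i \<Rightarrow> 'a set) \<Rightarrow> 'b topology \<Rightarrow> ('i \<Rightarrow> 'b set) \<Rightarrow> 'a set \<Rightarrow> 'b set" where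
  "transport U Y W V = Y interior_of (Y closure_of (\<Union>i\<in>{i. U i \<subseteq> V}. W i))"

lemma regular_open_transport: "regular_open Y (transport U Y W V)"
  unfolding transport_def by (rule regular_open_interior_of_closure_of)

lemma transport_mono: "V \<subseteq> V' \<Longrightarrow> transport U Y W V \<subseteq> transport U Y W V'"
  unfolding transport_def by (intro interior_of_mono closure_of_mono) auto

text \<open>The members below \<open>V\<close> are dense in \<open>V\<close>: otherwise the part of
  \<open>V\<close> off the closure of their union would contain another member, which is itself one
  of those below \<open>V\<close>.\<close>

lemma transport_self:
  assumes U: "pi_base X U" and V: "regular_open X V"
  shows "transport U X U V = V"
proof
  let ?S = "\<Union>i\<in>{i. U i \<subseteq> V}. U i"
  show "transport U X U V \<subseteq> V"
    unfolding transport_def using V by (rule regularization_subset) auto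
  have "V \<subseteq> X closure_of ?S"
  proof (rule ccontr)
    assume "\<not> V \<subseteq> X closure_of ?S"
    moreover have "openin X (V - X closure_of ?S)"
      by (simp add: V openin_diff regular_openD(1))
    ultimately obtain i where i: "U i \<subseteq> V - X closure_of ?S"
      using U unfolding pi_base_def by (metis Diff_eq_empty_iff)
    moreover have "U i \<subseteq> X closure_of ?S"
    proof -
      have "U i \<subseteq> ?S" using i by auto
      moreover have "?S \<subseteq> topspace X"
        using regular_openD(1)[OF V] openin_subset by fastforce
      ultimately show ?thesis
        using closure_of_subset by blast
    qed
    ultimately have "U i = {}" by blast
    then show False
      using U by (simp add: pi_base_def)
  qed
  then show "V \<subseteq> transport U X U V"
    unfolding transport_def by (simp add: V interior_of_maximal regular_openD(1))
qed

text \<open>The regularised union adds no new index. If \<open>U i\<close> is not below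
  \<open>V\<close>, some \<open>U j\<close> inside \<open>U i\<close> avoids cl V; but on the other
  side \<open>W j\<close> meets some \<open>W k\<close> with \<open>U k\<close> below
  \<open>V\<close>, so \<open>U j\<close> would meet \<open>V\<close>.\<close>

lemma subset_transport_iff:
  assumes U: "pi_base X U" and W: "pi_base Y W"
    and UW: "\<And>i j. U i \<inter> U j = {} \<longleftrightarrow> W i \<inter> W j = {}"
    and V: "regular_open X V"
  shows "W i \<subseteq> transport U Y W V \<longleftrightarrow> U i \<subseteq> V"
proof
  let ?S = "\<Union>i\<in>{i. U i \<subseteq> V}. W i"
  have opU: "openin X (U i)" "U i \<noteq> {}" and opW: "openin Y (W i)" "W i \<noteq> {}" for i
    using U W by (auto simp: pi_base_def)
  {
    assume "U i \<subseteq> V"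
    then show "W i \<subseteq> transport U Y W V"
      unfolding transport_def using opW
      by (intro openin_subset_regularization) (auto dest: openin_subset)
  next
    assume L: "W i \<subseteq> transport U Y W V"
    show "U i \<subseteq> V"
    proof (rule ccontr)
      assume "\<not> U i \<subseteq> V"
      then have "\<not> U i \<subseteq> X closure_of V"
        using subset_regular_open[OF V opU(1)] by blast
      moreover have "openin X (U i - X closure_of V)"
        by (simp add: opU openin_diff)
      ultimately obtain j where j: "U j \<subseteq> U i - X closure_of V"
        using U unfolding pi_base_def by (metis Diff_eq_empty_iff)
      then have "U i \<inter> U j \<noteq> {}"
        using opU(2)[of j] by blast
      \<comment> \<open>\<open>U j \<subseteq> U i\<close> only tells that \<open>W j\<close> meets
        \<open>W i\<close>, not that it is contained in it; so the density argument is run on the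
        open set \<open>W i \<inter> W j\<close>.\<close>
      then have ne: "W i \<inter> W j \<noteq> {}"
        using UW by blast
      moreover have "W i \<inter> W j \<subseteq> Y closure_of ?S"
        using L unfolding transport_def using interior_of_subset by fastforce
      ultimately have "W i \<inter> W j \<inter> ?S \<noteq> {}"
        using openin_Int_closure_of_eq_empty[of Y "W i \<inter> W j" ?S] opW by blast
      then obtain k where k: "U k \<subseteq> V" "W j \<inter> W k \<noteq> {}"
        by blast
      then have "U j \<inter> U k \<noteq> {}"
        using UW by blast
      then have "U j \<inter> V \<noteq> {}"
        using k by blast
      moreover have "V \<subseteq> X closure_of V"
        by (simp add: V closure_of_subset openin_subset regular_openD(1))
      ultimately show False
        using j by blast
    qed
  }
qed

text \<open>The way back collects exactly the indices with \<open>U i\<close> below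
  \<open>V\<close>, so the round trip is the transport of \<open>V\<close> from \<open>U\<close> to
  itself.\<close>

lemma transport_transport:
  assumes "pi_base X U" and "pi_base Y W"
    and "\<And>i j. U i \<inter> U j = {} \<longleftrightarrow> W i \<inter> W j = {}"
    and "regular_open X V"
  shows "transport W X U (transport U Y W V) = V"
proof -
  have "transport W X U (transport U Y W V) = transport U X U V"
    unfolding transport_def[of W] transport_def[of U X]
    by (simp add: subset_transport_iff[OF assms])
  then show ?thesis
    using transport_self assms by metis
qed

lemma boolean_equivalent_pi_base:
  assumes "pi_base X U" and "pi_base Y W"
    and "\<And>i j. U i \<inter> U j = {} \<longleftrightarrow> W i \<inter> W j = {}"
  shows "boolean_equivalent X Y"
proof (rule boolean_equivalentI[where h="transport U Y W" and g="transport W X U"])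
  show "transport W X U (transport U Y W V) = V" if "regular_open X V" for V
    using transport_transport[OF assms that] .
  show "transport U Y W (transport W X U V) = V" if "regular_open Y V" for V
    using transport_transport[OF assms(2,1) _ that] assms(3) by blast
qed (simp_all add: regular_open_transport transport_mono)

section \<open>Binary \<open>\<pi>\<close>-bases of perfect spaces\<close>

text \<open>A non-empty open set without isolated points has two points, which disjoint open sets
  separate. One piece is cut out around the first point; the other is all of \<open>G\<close> off
  its closure, so that the two pieces together are dense in \<open>G\<close>.\<close>

lemma perfect_split:
  assumes X: "Hausdorff_space X" "perfect_topology X"
    and G: "openin X G" "G \<noteq> {}" and B: "openin X B"
  obtains S :: "bool \<Rightarrow> 'a set" where
    "\<And>b. openin X (S b)" "\<And>b. S b \<noteq> {}" "\<And>b. S b \<subseteq> G" "S False \<inter> S True = {}"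
    "\<And>H. openin X H \<Longrightarrow> H \<inter> G \<noteq> {} \<Longrightarrow> \<exists>b. H \<inter> S b \<noteq> {}"
    "G \<inter> B \<noteq> {} \<Longrightarrow> S False \<subseteq> B"
proof -
  \<comment> \<open>The first piece is cut out of \<open>A\<close>. If \<open>G\<close> misses
    \<open>B\<close>, the last conclusion is vacuous and \<open>A\<close> is just
    \<open>G\<close>.\<close>
  define A where "A = (if G \<inter> B = {} then G else G \<inter> B)"
  have A: "openin X A" "A \<noteq> {}" "A \<subseteq> G" "G \<inter> B \<noteq> {} \<Longrightarrow> A \<subseteq> B"
    using G B by (auto simp: A_def)
  obtain p where p: "p \<in> A"
    using A by auto
  have "A \<noteq> {p}"
    using X(2) A openin_subset p by (metis isolated_point_def perfect_topology_def subsetD)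
  then obtain q where q: "q \<in> A" "p \<noteq> q"
    using p by blast
  then obtain P Q where PQ: "openin X P" "openin X Q" "p \<in> P" "q \<in> Q" "disjnt P Q"
    using X(1) p openin_subset[OF A(1)] unfolding Hausdorff_space_def by (metis subsetD)
  let ?S = "\<lambda>b. if b then G - X closure_of (A \<inter> P) else A \<inter> P"
  have AP: "openin X (A \<inter> P)" "A \<inter> P \<subseteq> X closure_of (A \<inter> P)"
    using A(1) PQ(1) by (simp_all add: closure_of_subset openin_subset openin_Int)
  \<comment> \<open>\<open>Q\<close> is a neighbourhood of \<open>q\<close> that misses
    \<open>P\<close>; this makes the second piece non-empty.\<close>
  have "q \<notin> X closure_of (A \<inter> P)"
    using PQ unfolding in_closure_of disjnt_def by blast
  then have "q \<in> ?S True"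
    using q A by auto
  show thesis
  proof (rule that[of ?S])
    show "\<exists>b. H \<inter> ?S b \<noteq> {}" if "openin X H" "H \<inter> G \<noteq> {}" for H
    proof (rule ccontr)
      assume "\<not> (\<exists>b. H \<inter> ?S b \<noteq> {})"
      then have "H \<inter> ?S False = {}" "H \<inter> ?S True = {}"
        by blast+
      \<comment> \<open>An open set that misses the first piece misses its closure, whereas missing
        the second piece forces \<open>H \<inter> G\<close> into that closure.\<close>
      then have "H \<inter> X closure_of (A \<inter> P) = {}" "H \<inter> G \<subseteq> X closure_of (A \<inter> P)"
        using openin_Int_closure_of_eq_empty[OF that(1)] by auto
      then show False
        using that by blast
    qed
  qed (use A G AP p PQ \<open>q \<in> ?S True\<close> in \<open>auto simp: openin_diff\<close>)
qed

text \<open>New letters are consed at the front, so a path from the root is read from the right and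
  ancestors are suffixes. The splitting function also receives the level \<open>length s\<close>,
  which selects the basic set to be treated there.\<close>

primrec tree :: "('a set \<Rightarrow> nat \<Rightarrow> bool \<Rightarrow> 'a set) \<Rightarrow> 'a set \<Rightarrow> bool list \<Rightarrow> 'a set" where
  "tree \<sigma> A [] = A"
| "tree \<sigma> A (b # s) = \<sigma> (tree \<sigma> A s) (length s) b"

lemma perfect_space_binary_pi_base:
  assumes X: "Hausdorff_space X" "perfect_topology X" "second_countable X" "topspace X \<noteq> {}"
  obtains U :: "bool list \<Rightarrow> 'a set" where
    "pi_base X U" "\<And>s t. U s \<inter> U t = {} \<longleftrightarrow> \<not> suffix s t \<and> \<not> suffix t s"
proof -
  obtain \<B> where \<B>: "countable \<B>" "\<And>V. V \<in> \<B> \<Longrightarrow> openin X V"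
    "\<And>G x. openin X G \<Longrightarrow> x \<in> G \<Longrightarrow> \<exists>V\<in>\<B>. x \<in> V \<and> V \<subseteq> G"
    using X(3) by (auto simp: second_countable_def)
  moreover have "\<B> \<noteq> {}"
    using X(4) \<B>(3)[OF openin_topspace] by blast
  ultimately obtain B :: "nat \<Rightarrow> 'a set" where B: "range B = \<B>"
    using range_from_nat_into by metis
  have opB: "openin X (B n)" for n
    using B \<B>(2) by blast
  \<comment> \<open>The guard on \<open>G\<close> stands under the existential quantifier so that
    choice gives a total \<open>\<sigma>\<close>, unspecified where the guard fails.\<close>
  have "\<forall>G n. \<exists>S. openin X G \<and> G \<noteq> {} \<longrightarrow> (\<forall>b. openin X (S b)) \<and> (\<forall>b. S b \<noteq> {}) \<and> (\<forall>b. S b \<subseteq> G) \<and>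
      S False \<inter> S True = {} \<and> (\<forall>H. openin X H \<longrightarrow> H \<inter> G \<noteq> {} \<longrightarrow> (\<exists>b::bool. H \<inter> S b \<noteq> {})) \<and>
      (G \<inter> B n \<noteq> {} \<longrightarrow> S False \<subseteq> B n)"
    (is "\<forall>G n. \<exists>S. ?P G n S")
  proof (intro allI)
    fix G n
    show "\<exists>S. ?P G n S"
    proof (cases "openin X G \<and> G \<noteq> {}")
      case True
      then obtain S :: "bool \<Rightarrow> 'a set" where
        "\<And>b. openin X (S b)" "\<And>b. S b \<noteq> {}" "\<And>b. S b \<subseteq> G" "S False \<inter> S True = {}"
        "\<And>H. openin X H \<Longrightarrow> H \<inter> G \<noteq> {} \<Longrightarrow> \<exists>b. H \<inter> S b \<noteq> {}"
        "G \<inter> B n \<noteq> {} \<Longrightarrow> S False \<subseteq> B n"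
        using perfect_split[OF X(1,2) _ _ opB[of n]] by metis
      then show ?thesis by (intro exI[of _ S]) blast
    qed blast
  qed
  then obtain \<sigma> where \<sigma>: "\<And>G n. openin X G \<and> G \<noteq> {} \<Longrightarrow>
      (\<forall>b. openin X (\<sigma> G n b)) \<and> (\<forall>b. \<sigma> G n b \<noteq> {}) \<and> (\<forall>b. \<sigma> G n b \<subseteq> G) \<and>
      \<sigma> G n False \<inter> \<sigma> G n True = {} \<and>
      (\<forall>H. openin X H \<longrightarrow> H \<inter> G \<noteq> {} \<longrightarrow> (\<exists>b::bool. H \<inter> \<sigma> G n b \<noteq> {})) \<and>
      (G \<inter> B n \<noteq> {} \<longrightarrow> \<sigma> G n False \<subseteq> B n)"
    by metis
  define U where "U = tree \<sigma> (topspace X)"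
  have U_Nil: "U [] = topspace X" and U_Cons: "U (b # s) = \<sigma> (U s) (length s) b" for b s
    by (simp_all add: U_def)
  have op: "openin X (U s) \<and> U s \<noteq> {}" for s
    by (induction s) (use X(4) \<sigma> in \<open>auto simp: U_Nil U_Cons\<close>)
  have child: "U (b # s) \<subseteq> U s" "U (False # s) \<inter> U (True # s) = {}"
    "U s \<inter> B (length s) \<noteq> {} \<Longrightarrow> U (False # s) \<subseteq> B (length s)" for b s
    using \<sigma>[OF op[of s]] by (auto simp: U_Cons)
  have dense_child: "\<exists>b. H \<inter> U (b # s) \<noteq> {}" if "openin X H" "H \<inter> U s \<noteq> {}" for H s
    using \<sigma>[OF op[of s]] that by (simp add: U_Cons)
  have append: "U (r @ s) \<subseteq> U s" for r s
    by (induction r) (use child(1) in auto)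
  \<comment> \<open>Distinct words of equal length either have distinct tails, so that their parents
    are already disjoint, or are siblings.\<close>
  have level: "U s \<inter> U t = {}" if "length s = length t" "s \<noteq> t" for s t
    using that
  proof (induction s t rule: list_induct2)
    case (Cons a s b t)
    show ?case
    proof (cases "s = t")
      case True
      then show ?thesis
        using Cons.prems child(2)[of t] by (cases a; cases b) auto
    next
      case False
      then show ?thesis
        using Cons.IH child(1) by blast
    qed
  qed simp
  have disj: "U s \<inter> U t = {}" if "length s \<le> length t" "\<not> suffix s t" for s t
  proof -
    \<comment> \<open>Dropping \<open>?k\<close> letters leaves the ancestor of \<open>t\<close> on
      the level of \<open>s\<close>, where \<open>level\<close> applies.\<close>
    let ?k = "length t - length s"
    have "s \<noteq> drop ?k t"
      using that(2) suffix_drop by metis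
    then have "U s \<inter> U (drop ?k t) = {}"
      using that(1) by (intro level) simp_all
    moreover have "U t \<subseteq> U (drop ?k t)"
      using append[of "take ?k t" "drop ?k t"] by simp
    ultimately show ?thesis by blast
  qed
  have meet: "U s \<inter> U t \<noteq> {}" if "suffix s t" for s t
    using that append op unfolding suffix_def by (metis Int_absorb1)
  \<comment> \<open>The pieces of one level need not cover the space; their union being dense is
    enough and survives each split.\<close>
  have dense_level: "\<exists>s. length s = n \<and> H \<inter> U s \<noteq> {}" if "openin X H" "H \<noteq> {}" for H n
  proof (induction n)
    case 0
    then show ?case
      using that openin_subset by (fastforce simp: U_Nil)
  next
    case (Suc n)
    then show ?case
      using dense_child[OF that(1)] by (metis length_Cons)
  qed
  show thesis
  proof (rule that)
    have "\<exists>s. U s \<subseteq> G" if G: "openin X G" "G \<noteq> {}" for G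
    proof -
      \<comment> \<open>The basic set \<open>B n\<close> is treated at level \<open>n\<close>: a
        piece of that level meets it, and the \<open>False\<close> child of this piece was chosen
        inside it.\<close>
      obtain n where n: "B n \<noteq> {}" "B n \<subseteq> G"
        using \<B>(3) G B by (metis all_not_in_conv imageE)
      then obtain s where "length s = n" "U s \<inter> B n \<noteq> {}"
        using dense_level[OF opB] by (metis Int_commute)
      then have "U (False # s) \<subseteq> B n"
        using child(3) by blast
      with n show ?thesis by blast
    qed
    then show "pi_base X U"
      using op by (simp add: pi_base_def)
    show "U s \<inter> U t = {} \<longleftrightarrow> \<not> suffix s t \<and> \<not> suffix t s" for s t
      using disj meet by (metis Int_commute nat_le_linear)
  qed
qed

text \<open>Both spaces get \<pi>-bases over the same full binary tree, and in both the disjointness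
  pattern is incomparability of words.\<close>

lemma perfect_spaces_boolean_equivalent:
  assumes "Hausdorff_space X" "perfect_topology X" "second_countable X" "topspace X \<noteq> {}"
    and "Hausdorff_space Y" "perfect_topology Y" "second_countable Y" "topspace Y \<noteq> {}"
  shows "boolean_equivalent X Y"
proof -
  obtain U :: "bool list \<Rightarrow> 'a set" where
    U: "pi_base X U" "\<And>s t. U s \<inter> U t = {} \<longleftrightarrow> \<not> suffix s t \<and> \<not> suffix t s"
    using perfect_space_binary_pi_base[OF assms(1-4)] by metis
  obtain W :: "bool list \<Rightarrow> 'b set" where
    W: "pi_base Y W" "\<And>s t. W s \<inter> W t = {} \<longleftrightarrow> \<not> suffix s t \<and> \<not> suffix t s"
    using perfect_space_binary_pi_base[OF assms(5-8)] by metis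
  show ?thesis
    by (rule boolean_equivalent_pi_base[OF U(1) W(1)]) (simp add: U(2) W(2))
qed

section \<open>Second countability of compact metric spaces\<close>

text \<open>Total boundedness gives, for each n, a finite cover by balls of radius 1/(n+1); all
  these balls together form a countable base.\<close>

lemma (in Metric_space) compact_space_imp_second_countable:
  assumes "compact_space mtopology"
  shows "second_countable mtopology"
proof -
  have "mtotally_bounded M"
    using assms compact_space_eq_mcomplete_mtotally_bounded by blast
  then have "\<forall>n. \<exists>K. finite K \<and> K \<subseteq> M \<and> M \<subseteq> (\<Union>x\<in>K. mball x (inverse (Suc n)))"
    unfolding mtotally_bounded_def by simp
  then obtain K where K: "\<And>n. finite (K n)" "\<And>n. M \<subseteq> (\<Union>x\<in>K n. mball x (inverse (Suc n)))"
    by metis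
  define \<B> where "\<B> = (\<Union>n. (\<lambda>x. mball x (inverse (Suc n))) ` K n)"
  have "countable \<B>"
    unfolding \<B>_def using K(1) by (auto intro: countable_finite)
  moreover have "\<forall>V\<in>\<B>. openin mtopology V"
    by (auto simp: \<B>_def)
  moreover have "\<exists>V\<in>\<B>. x \<in> V \<and> V \<subseteq> G" if G: "openin mtopology G" "x \<in> G" for G x
  proof -
    obtain r where r: "r > 0" "mball x r \<subseteq> G" and "x \<in> M"
      using G unfolding openin_mtopology by blast
    \<comment> \<open>Half of \<open>r\<close>, since both \<open>x\<close> and an arbitrary point
      of the chosen ball are compared with its centre \<open>y\<close>.\<close>
    obtain n where n: "inverse (Suc n) < r / 2"
      using reals_Archimedean[of "r / 2"] r by auto
    obtain y where y: "y \<in> K n" "x \<in> mball y (inverse (Suc n))"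
      using K(2) \<open>x \<in> M\<close> by blast
    have "mball y (inverse (Suc n)) \<subseteq> mball x r"
    proof
      fix z assume z: "z \<in> mball y (inverse (Suc n))"
      then have "d x z \<le> d x y + d y z"
        using y triangle by auto
      also have "\<dots> < r"
        using y z n commute by auto
      finally show "z \<in> mball x r"
        using z \<open>x \<in> M\<close> by simp
    qed
    then show ?thesis
      using y r unfolding \<B>_def by blast
  qed
  ultimately show ?thesis
    unfolding second_countable_def by blast
qed

section \<open>The Cantor set\<close>

lemma cantor_step_iterate_subset: "(cantor_step ^^ n) {0..1} \<subseteq> {0..1}"
proof (induction n)
  case (Suc n)
  have "cantor_step {0..1} \<subseteq> {0..1}"
    by (auto simp: cantor_step_def)
  moreover have "cantor_step ((cantor_step ^^ n) {0..1}) \<subseteq> cantor_step {0..1}"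
    using Suc unfolding cantor_step_def by blast
  ultimately show ?case by simp
qed simp

lemma cantor_set_subset: "cantor_set \<subseteq> {0..1}"
  using cantor_step_iterate_subset unfolding cantor_set_def by blast

text \<open>Self-similarity of the Cantor set. The delicate inclusion needs one preimage of
  \<open>x\<close> that lies in all stages at once, although each stage only offers its own.\<close>

lemma cantor_step_cantor_set: "cantor_step cantor_set = cantor_set"
proof
  show "cantor_step cantor_set \<subseteq> cantor_set"
  proof
    fix x assume x: "x \<in> cantor_step cantor_set"
    have "x \<in> (cantor_step ^^ n) {0..1}" for n
    proof (cases n)
      case 0
      then show ?thesis
        using x cantor_set_subset unfolding cantor_step_def by fastforce
    next
      case (Suc m)
      have "cantor_set \<subseteq> (cantor_step ^^ m) {0..1}"
        by (auto simp: cantor_set_def)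
      then show ?thesis
        using x Suc unfolding cantor_step_def by auto
    qed
    then show "x \<in> cantor_set"
      by (simp add: cantor_set_def)
  qed
  show "cantor_set \<subseteq> cantor_step cantor_set"
  proof
    fix x assume x: "x \<in> cantor_set"
    have y: "\<exists>y\<in>(cantor_step ^^ n) {0..1}. 0 \<le> y \<and> y \<le> 1 \<and> (y = 3 * x \<or> y = 3 * x - 2)" for n
    proof -
      have "x \<in> cantor_step ((cantor_step ^^ n) {0..1})"
        using x unfolding cantor_set_def by (metis INT_iff UNIV_I comp_apply funpow.simps(2))
      then obtain y where "y \<in> (cantor_step ^^ n) {0..1}" "x = y / 3 \<or> x = (y + 2) / 3"
        unfolding cantor_step_def[of "(cantor_step ^^ n) {0..1}"] by blast
      moreover from this have "0 \<le> y" "y \<le> 1"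
        using cantor_step_iterate_subset[of n] by auto
      ultimately show ?thesis
        by (intro bexI[of _ y]) auto
    qed
    \<comment> \<open>The point 1/2 lies in the removed middle third, so the side of 1/2 on which
      \<open>x\<close> lies fixes the branch independently of the stage \<open>n\<close>.\<close>
    have "3 * x \<in> (cantor_step ^^ n) {0..1}" if "x \<le> 1/2" for n
      using y[of n] that by auto
    moreover have "3 * x - 2 \<in> (cantor_step ^^ n) {0..1}" if "\<not> x \<le> 1/2" for n
      using y[of n] that by auto
    ultimately have "3 * x \<in> cantor_set \<or> 3 * x - 2 \<in> cantor_set"
      unfolding cantor_set_def by blast
    then show "x \<in> cantor_step cantor_set"
      using image_eqI[of x "\<lambda>x. x / 3" "3 * x" cantor_set]
        image_eqI[of x "\<lambda>x. (x + 2) / 3" "3 * x - 2" cantor_set]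
      unfolding cantor_step_def by auto
  qed
qed

text \<open>0 and 1 are the fixed points of the two maps in \<open>cantor_step\<close>, so they
  survive every stage.\<close>

lemma zero_one_in_cantor_set: "0 \<in> cantor_set" "1 \<in> cantor_set"
proof -
  have "0 \<in> (cantor_step ^^ n) {0..1} \<and> 1 \<in> (cantor_step ^^ n) {0..1}" for n
    by (induction n) (auto simp: cantor_step_def image_iff intro: bexI[of _ 0] bexI[of _ 1])
  then show "0 \<in> cantor_set" "1 \<in> cantor_set"
    by (auto simp: cantor_set_def)
qed

text \<open>By self-similarity \<open>x\<close> is the image of some \<open>c\<close> in the set,
  and the map involved shrinks the distance from \<open>c\<close> to a neighbour by the factor 3.
  The induction starts with an endpoint different from \<open>x\<close>.\<close>

lemma cantor_set_close_point:
  assumes "x \<in> cantor_set"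
  shows "\<exists>y\<in>cantor_set. y \<noteq> x \<and> \<bar>y - x\<bar> \<le> 1 / 3 ^ n"
  using assms
proof (induction n arbitrary: x)
  case 0
  then have "0 \<le> x" "x \<le> 1"
    using cantor_set_subset by auto
  then show ?case
    using zero_one_in_cantor_set
    by (cases "x = 0") (auto intro: bexI[of _ 0] bexI[of _ 1])
next
  case (Suc n)
  then have "x \<in> cantor_step cantor_set"
    by (simp add: cantor_step_cantor_set)
  \<comment> \<open>The offset \<open>e\<close> records the branch, so that both maps are treated as
    \<open>(c + e) / 3\<close>.\<close>
  then obtain c e where c: "c \<in> cantor_set" "x = (c + e) / 3" "e = 0 \<or> e = 2"
    unfolding cantor_step_def by force
  obtain y where y: "y \<in> cantor_set" "y \<noteq> c" "\<bar>y - c\<bar> \<le> 1 / 3 ^ n"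
    using Suc.IH[OF c(1)] by blast
  have "(y + e) / 3 \<in> cantor_step cantor_set"
    using y c(3) unfolding cantor_step_def by auto
  moreover have "\<bar>(y + e) / 3 - x\<bar> = \<bar>y - c\<bar> / 3"
    by (simp add: c(2) flip: diff_divide_distrib)
  then have "\<bar>(y + e) / 3 - x\<bar> \<le> 1 / 3 ^ Suc n"
    using y(3) by simp
  ultimately show ?case
    using y(2) unfolding cantor_step_cantor_set c(2)
    by (intro bexI[of _ "(y + e) / 3"] conjI) simp_all
qed

lemma perfect_cantor_set: "perfect_topology (top_of_set cantor_set)"
  unfolding perfect_topology_def
proof
  assume "\<exists>x. isolated_point (top_of_set cantor_set) x"
  then obtain x where x: "x \<in> cantor_set" "openin (top_of_set cantor_set) {x}"
    by (auto simp: isolated_point_def)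
  then obtain e where e: "e > 0" "ball x e \<inter> cantor_set \<subseteq> {x}"
    by (auto simp: openin_contains_ball)
  obtain n where n: "(1 / 3) ^ n < e"
    using real_arch_pow_inv[of e "1/3"] e by auto
  obtain y where "y \<in> cantor_set" "y \<noteq> x" "\<bar>y - x\<bar> \<le> 1 / 3 ^ n"
    using cantor_set_close_point[OF x(1)] by blast
  with n e show False
    by (auto simp: subset_iff dist_real_def power_one_over abs_minus_commute)
qed

lemma second_countable_euclidean:
  "second_countable (euclidean :: 'a::second_countable_topology topology)"
proof -
  obtain \<B> :: "'a set set" where "countable \<B>" "topological_basis \<B>"
    using ex_countable_basis by blast
  then show ?thesis
    unfolding second_countable_def open_openin[symmetric]
    by (metis topological_basis_open topological_basisE)
qed

text \<open>The empty space is compact and has no isolated points, but its regular open algebra has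
  a single element; hence the assumption that \<open>X\<close> is non-empty.\<close>

theorem proposition5p6:
  fixes X :: "'a metric"
  assumes "mspace X \<noteq> {}"
    and "compact_space (mtopology_of X)"
    and "perfect_topology (mtopology_of X)"
  shows "boolean_equivalent (mtopology_of X) (top_of_set cantor_set)"
proof (rule perfect_spaces_boolean_equivalent)
  interpret Metric_space "mspace X" "mdist X"
    by simp
  show "Hausdorff_space (mtopology_of X)"
    by (simp add: mtopology_of_def Hausdorff_space_mtopology)
  show "second_countable (mtopology_of X)"
    using assms(2) by (simp add: mtopology_of_def compact_space_imp_second_countable)
  show "Hausdorff_space (top_of_set cantor_set)"
    by (simp add: Hausdorff_space_subtopology)
  show "second_countable (top_of_set cantor_set)"
    by (simp add: second_countable_subtopology second_countable_euclidean)
  show "topspace (top_of_set cantor_set) \<noteq> {}"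
    using zero_one_in_cantor_set by auto
qed (use assms perfect_cantor_set in auto)

end
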